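(* Let $(G,\sigma)$ be a finite, connected, unbalanced magnetic graph with an entire signature $\sigma$ taking values in $S^1_\ell$, $\ell\ge 1$. Let $n\in(1,\infty)$ and $\kappa\in\mathbb{R}\setminus\{0\}$. If $(G,\sigma)$ satisfies $CD^\sigma(n,\kappa)$ and $f:V\to\mathbb{C}$ is a (nonzero) eigenfunction of $-\Delta^\sigma$ with eigenvalue $\lambda>0$, i.e. $-\Delta^\sigma f=\lambda f$, then for every $x\in V$ $$|\nabla^\sigma f|^2(x)\le\left(\left(8-\frac{2}{n}\right)\lambda-4\kappa\right)\max_{z\in V}|f(z)|^2 .$$
   Context: Graphs: $G=(V,E,p)$ has a finite vertex set $V$, a set $E$ of undirected edges with no loops and no multiple edges, and a nonnegative symmetric edge weight $p_{xy}=p_{yx}$ for each edge $\{x,y\}$. Write $x\sim y$ for adjacency. The degree is $d_x=\sum_{y\sim x}p_{xy}$, and $d_x>0$ for every $x\in V$. $V^{\mathbb{C}}$ is the space of functions $V\to\mathbb{C}$. Signatures: let $S^1_\ell=\{z\in\mathbb{C}:z^\ell=1\}$. A signature is a map $\sigma:E^{\mathrm{or}}\to S^1_\ell$ on the set $E^{\mathrm{or}}$ of ordered pairs $(x,y)$ with $x\sim y$, such that $\sigma_{yx}=\sigma_{xy}^{-1}$; the pair $(G,\sigma)$ is called a magnetic graph. The signature is entire if its range generates the group $S^1_\ell$. $(G,\sigma)$ is balanced if the product of $\sigma$ along every directed cycle is $1$, and unbalanced otherwise. Operators on $V^{\mathbb{C}}$: $$(\Delta f)(x)=\frac1{d_x}\sum_{y\sim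 x}p_{xy}(f(y)-f(x)),\qquad (\Delta^\sigma f)(x)=\frac1{d_x}\sum_{y\sim x}p_{xy}(\sigma_{xy}f(y)-f(x)),$$ $$2\Gamma^\sigma(f,g)=\Delta(f\overline g)-f\,\overline{\Delta^\sigma g}-(\Delta^\sigma f)\overline g,$$ $$2\Gamma_2^\sigma(f,g)=\Delta\Gamma^\sigma(f,g)-\Gamma^\sigma(f,\Delta^\sigma g)-\Gamma^\sigma(\Delta^\sigma f,g),$$ $$|\nabla^\sigma f|^2(x)=2\Gamma^\sigma(f,f)(x)=\frac1{d_x}\sum_{y\sim x}p_{xy}|\sigma_{xy}f(y)-f(x)|^2 .$$ $(G,\sigma)$ satisfies $CD^\sigma(n,\kappa)$ if for every $f\in V^{\mathbb{C}}$ and at every vertex, $\Gamma_2^\sigma(f,f)\ge\frac1n|\Delta^\sigma f|^2+\kappa\,\Gamma^\sigma(f,f)$. *)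

theory Defs
  imports Complex_Main "HOL-Algebra.Generated_Groups"
begin

text \<open>
  An edge is a two-element subset of the vertex set, which excludes loops and multiple edges.
  Weights and signatures are total functions on pairs; only their values on pairs
  \<open>x, y\<close> with \<open>{x, y} \<in> E\<close> matter.  A weight may vanish on an edge; adjacency is
  membership in \<open>E\<close>, not positivity of the weight.
  Functions on the vertex set are represented by functions on the whole type; at vertices, the
  operators below depend only on the values at vertices.
\<close>

definition nbrs :: "'a set set \<Rightarrow> 'a \<Rightarrow> 'a set" where
  "nbrs E x = {y. {x, y} \<in> E}"

definition degree :: "'a set set \<Rightarrow> ('a \<Rightarrow> 'a \<Rightarrow> real) \<Rightarrow> 'a \<Rightarrow> real" where
  "degree E p x = (\<Sum>y\<in>nbrs E x. p x y)"

locale weighted_graph =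
  fixes V :: "'a set" and E :: "'a set set" and p :: "'a \<Rightarrow> 'a \<Rightarrow> real"
  assumes finite_vertices: "finite V"
    and edges: "\<And>e. e \<in> E \<Longrightarrow> e \<subseteq> V \<and> card e = 2"
    and weight_nonneg: "\<And>x y. {x, y} \<in> E \<Longrightarrow> 0 \<le> p x y"
    and weight_sym: "\<And>x y. {x, y} \<in> E \<Longrightarrow> p x y = p y x"
    and degree_pos: "\<And>x. x \<in> V \<Longrightarrow> 0 < degree E p x"

definition graph_connected :: "'a set \<Rightarrow> 'a set set \<Rightarrow> bool" where
  "graph_connected V E \<longleftrightarrow>
     V \<noteq> {} \<and> (\<forall>x\<in>V. \<forall>y\<in>V. (x, y) \<in> {(u, v). {u, v} \<in> E}\<^sup>*)"

definition unity_roots :: "nat \<Rightarrow> complex monoid" where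
  "unity_roots l = \<lparr>carrier = {z. z ^ l = 1}, mult = (*), one = 1\<rparr>"

locale magnetic_graph = weighted_graph V E p
  for V :: "'a set" and E :: "'a set set" and p :: "'a \<Rightarrow> 'a \<Rightarrow> real" +
  fixes l :: nat and \<sigma> :: "'a \<Rightarrow> 'a \<Rightarrow> complex"
  assumes sig_range: "\<And>x y. {x, y} \<in> E \<Longrightarrow> \<sigma> x y \<in> carrier (unity_roots l)"
    and sig_inverse: "\<And>x y. {x, y} \<in> E \<Longrightarrow> \<sigma> y x = inverse (\<sigma> x y)"

definition entire_signature :: "'a set set \<Rightarrow> nat \<Rightarrow> ('a \<Rightarrow> 'a \<Rightarrow> complex) \<Rightarrow> bool" where
  "entire_signature E l \<sigma> \<longleftrightarrow>
     generate (unity_roots l) {\<sigma> x y | x y. {x, y} \<in> E} = carrier (unity_roots l)"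

text \<open>
  A directed cycle is the list of its distinct vertices in order; the closing edge joins the last
  vertex to the first.  Closed walks of length 2 are not cycles; along them the signature product
  is 1 anyway.
\<close>

definition directed_cycle :: "'a set set \<Rightarrow> 'a list \<Rightarrow> bool" where
  "directed_cycle E xs \<longleftrightarrow> 3 \<le> length xs \<and> distinct xs \<and>
     (\<forall>i<length xs. {xs ! i, xs ! (Suc i mod length xs)} \<in> E)"

definition balanced :: "'a set set \<Rightarrow> ('a \<Rightarrow> 'a \<Rightarrow> complex) \<Rightarrow> bool" where
  "balanced E \<sigma> \<longleftrightarrow> (\<forall>xs. directed_cycle E xs \<longrightarrow>
     (\<Prod>i<length xs. \<sigma> (xs ! i) (xs ! (Suc i mod length xs))) = 1)"

definition laplacian ::
  "'a set set \<Rightarrow> ('a \<Rightarrow> 'a \<Rightarrow> real) \<Rightarrow> ('a \<Rightarrow> complex) \<Rightarrow> 'a \<Rightarrow> complex" where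
  "laplacian E p f x =
     (\<Sum>y\<in>nbrs E x. of_real (p x y) * (f y - f x)) / of_real (degree E p x)"

definition mag_laplacian ::
  "'a set set \<Rightarrow> ('a \<Rightarrow> 'a \<Rightarrow> real) \<Rightarrow> ('a \<Rightarrow> 'a \<Rightarrow> complex) \<Rightarrow> ('a \<Rightarrow> complex) \<Rightarrow> 'a \<Rightarrow> complex" where
  "mag_laplacian E p \<sigma> f x =
     (\<Sum>y\<in>nbrs E x. of_real (p x y) * (\<sigma> x y * f y - f x)) / of_real (degree E p x)"

definition Gamma ::
  "'a set set \<Rightarrow> ('a \<Rightarrow> 'a \<Rightarrow> real) \<Rightarrow> ('a \<Rightarrow> 'a \<Rightarrow> complex) \<Rightarrow>
    ('a \<Rightarrow> complex) \<Rightarrow> ('a \<Rightarrow> complex) \<Rightarrow> 'a \<Rightarrow> complex" where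
  "Gamma E p \<sigma> f g x =
     (laplacian E p (\<lambda>z. f z * cnj (g z)) x
       - f x * cnj (mag_laplacian E p \<sigma> g x)
       - mag_laplacian E p \<sigma> f x * cnj (g x)) / 2"

definition Gamma2 ::
  "'a set set \<Rightarrow> ('a \<Rightarrow> 'a \<Rightarrow> real) \<Rightarrow> ('a \<Rightarrow> 'a \<Rightarrow> complex) \<Rightarrow>
    ('a \<Rightarrow> complex) \<Rightarrow> ('a \<Rightarrow> complex) \<Rightarrow> 'a \<Rightarrow> complex" where
  "Gamma2 E p \<sigma> f g x =
     (laplacian E p (Gamma E p \<sigma> f g) x
       - Gamma E p \<sigma> f (mag_laplacian E p \<sigma> g) x
       - Gamma E p \<sigma> (mag_laplacian E p \<sigma> f) g x) / 2"

text \<open>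
  \<open>Gamma E p \<sigma> f f\<close> and \<open>Gamma2 E p \<sigma> f f\<close> are real-valued
  (\<open>Gamma_real\<close> and \<open>Gamma2_real\<close> below), so taking real parts loses nothing.
\<close>

definition grad_sq ::
  "'a set set \<Rightarrow> ('a \<Rightarrow> 'a \<Rightarrow> real) \<Rightarrow> ('a \<Rightarrow> 'a \<Rightarrow> complex) \<Rightarrow> ('a \<Rightarrow> complex) \<Rightarrow> 'a \<Rightarrow> real" where
  "grad_sq E p \<sigma> f x = 2 * Re (Gamma E p \<sigma> f f x)"

definition CD_ineq ::
  "'a set \<Rightarrow> 'a set set \<Rightarrow> ('a \<Rightarrow> 'a \<Rightarrow> real) \<Rightarrow> ('a \<Rightarrow> 'a \<Rightarrow> complex) \<Rightarrow> real \<Rightarrow> real \<Rightarrow> bool" where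
  "CD_ineq V E p \<sigma> n \<kappa> \<longleftrightarrow> (\<forall>f. \<forall>x\<in>V.
     Re (Gamma2 E p \<sigma> f f x)
       \<ge> (1 / n) * (cmod (mag_laplacian E p \<sigma> f x))\<^sup>2 + \<kappa> * Re (Gamma E p \<sigma> f f x))"

lemma cnj_laplacian: "cnj (laplacian E p f x) = laplacian E p (\<lambda>z. cnj (f z)) x"
  by (simp add: laplacian_def)

lemma cnj_Gamma: "cnj (Gamma E p \<sigma> f g x) = Gamma E p \<sigma> g f x"
proof -
  have "cnj (laplacian E p (\<lambda>z. f z * cnj (g z)) x) = laplacian E p (\<lambda>z. g z * cnj (f z)) x"
    by (simp add: cnj_laplacian mult.commute)
  thus ?thesis
    by (simp add: Gamma_def)
qed

lemma Gamma_real: "Gamma E p \<sigma> f f x \<in> \<real>"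
  by (simp add: Reals_cnj_iff cnj_Gamma)

lemma Gamma2_real: "Gamma2 E p \<sigma> f f x \<in> \<real>"
proof -
  have "cnj (laplacian E p (Gamma E p \<sigma> f f) x) = laplacian E p (Gamma E p \<sigma> f f) x"
    by (simp add: cnj_laplacian cnj_Gamma)
  thus ?thesis
    by (simp add: Reals_cnj_iff Gamma2_def cnj_Gamma)
qed

lemma (in magnetic_graph) grad_sq_eq:
  assumes "l \<ge> 1"
  shows "grad_sq E p \<sigma> f x =
    (\<Sum>y\<in>nbrs E x. p x y * (cmod (\<sigma> x y * f y - f x))\<^sup>2) / degree E p x"
proof -
  have norm1: "\<sigma> x y * cnj (\<sigma> x y) = 1" if "y \<in> nbrs E x" for y
  proof -
    have "\<sigma> x y ^ l = 1"
      using sig_range that by (auto simp: nbrs_def unity_roots_def)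
    hence "cmod (\<sigma> x y) ^ l = 1"
      by (simp flip: norm_power)
    hence "cmod (\<sigma> x y) = 1"
      using assms power_eq_imp_eq_base[of "cmod (\<sigma> x y)" l 1] by simp
    thus ?thesis
      by (simp add: complex_norm_square[symmetric])
  qed
  have "complex_of_real (\<Sum>y\<in>nbrs E x. p x y * (cmod (\<sigma> x y * f y - f x))\<^sup>2) =
    (\<Sum>y\<in>nbrs E x. of_real (p x y) * (f y * cnj (f y) - f x * cnj (f x)))
    - f x * (\<Sum>y\<in>nbrs E x. of_real (p x y) * cnj (\<sigma> x y * f y - f x))
    - (\<Sum>y\<in>nbrs E x. of_real (p x y) * (\<sigma> x y * f y - f x)) * cnj (f x)"
    unfolding sum_distrib_left sum_distrib_right sum_subtractf[symmetric] of_real_sum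
  proof (rule sum.cong[OF refl])
    fix y assume y: "y \<in> nbrs E x"
    have "(\<sigma> x y * f y - f x) * cnj (\<sigma> x y * f y - f x) =
      (\<sigma> x y * cnj (\<sigma> x y)) * (f y * cnj (f y)) - \<sigma> x y * f y * cnj (f x)
        - f x * cnj (\<sigma> x y * f y) + f x * cnj (f x)"
      by (simp add: algebra_simps)
    thus "complex_of_real (p x y * (cmod (\<sigma> x y * f y - f x))\<^sup>2) =
      of_real (p x y) * (f y * cnj (f y) - f x * cnj (f x))
      - f x * (of_real (p x y) * cnj (\<sigma> x y * f y - f x))
      - of_real (p x y) * (\<sigma> x y * f y - f x) * cnj (f x)"
      unfolding of_real_mult complex_norm_square
      using norm1[OF y] by (simp add: algebra_simps)
  qed
  hence "2 * Gamma E p \<sigma> f f x =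
    of_real ((\<Sum>y\<in>nbrs E x. p x y * (cmod (\<sigma> x y * f y - f x))\<^sup>2) / degree E p x)"
    unfolding Gamma_def laplacian_def mag_laplacian_def
    by (simp add: diff_divide_distrib)
  hence "Re (2 * Gamma E p \<sigma> f f x) =
    (\<Sum>y\<in>nbrs E x. p x y * (cmod (\<sigma> x y * f y - f x))\<^sup>2) / degree E p x"
    by (simp only: Re_complex_of_real)
  thus ?thesis
    unfolding grad_sq_def by simp
qed

end

theory Submission
  imports Defs
begin

text \<open>
  The argument is a maximum principle, in the style of Chung, Lin and Yau.  Write
  \<open>G = |\<nabla>\<^sup>\<sigma> f|\<^sup>2\<close> and \<open>g = |f|\<^sup>2\<close>.  For an eigenfunction the definition of
  \<open>\<Gamma>\<^sup>\<sigma>\<close> turns into the identity \<open>\<Delta> g = G - 2 \<lambda> g\<close>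
  (\<open>real_laplacian_norm_sq_eigenfunction\<close>), and the curvature-dimension
  inequality turns into the Bochner-type inequality
  \<open>\<Delta> G \<ge> (4/n) \<lambda>\<^sup>2 g + (2 \<kappa> - 2 \<lambda>) G\<close>
  (\<open>bochner_inequality\<close>).

  Put \<open>c = 4 \<lambda> - 2 \<kappa>\<close>.  At a maximum \<open>z\<close> of \<open>G + c g\<close> the Laplacian of this function
  is nonpositive, and the two relations combine to
  \<open>0 \<ge> 2 \<lambda> G + ((4/n) \<lambda>\<^sup>2 - 2 c \<lambda>) g\<close>, that is \<open>G(z) \<le> (c - (2/n) \<lambda>) g(z)\<close>.  Hence, for
  every vertex \<open>x\<close>,
  \<open>G(x) \<le> G(x) + c g(x) \<le> G(z) + c g(z) \<le> (2 c - (2/n) \<lambda>) g(z)\<close>,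
  and \<open>2 c - (2/n) \<lambda> = (8 - 2/n) \<lambda> - 4 \<kappa>\<close>.

  The first and the last passage to a maximum need \<open>c \<ge> 0\<close> and
  \<open>2 c - (2/n) \<lambda> \<ge> 0\<close>, which is not automatic when \<open>\<kappa>\<close> is large.  Both follow from the
  Lichnerowicz bound \<open>\<kappa> \<le> (1 - 1/n) \<lambda>\<close> (\<open>lichnerowicz_bound\<close>), obtained by integrating the same two relations
  against the degree measure, for which every Laplacian has mean zero.
\<close>

section \<open>The Laplacian on real functions\<close>

text \<open>
  \<open>Gamma\<close> is complex-valued, whereas maximum principles need an order; the real
  Laplacian is the real part of the complex one.
\<close>

definition real_laplacian ::
  "'a set set \<Rightarrow> ('a \<Rightarrow> 'a \<Rightarrow> real) \<Rightarrow> ('a \<Rightarrow> real) \<Rightarrow> 'a \<Rightarrow> real" where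
  "real_laplacian E p u x = (\<Sum>y\<in>nbrs E x. p x y * (u y - u x)) / degree E p x"

lemma Re_laplacian: "Re (laplacian E p F x) = real_laplacian E p (\<lambda>z. Re (F z)) x"
  by (simp add: laplacian_def real_laplacian_def Re_divide_of_real)

lemma real_laplacian_add:
  "real_laplacian E p (\<lambda>z. u z + v z) x = real_laplacian E p u x + real_laplacian E p v x"
  by (simp add: real_laplacian_def add_diff_add distrib_left sum.distrib add_divide_distrib)

lemma real_laplacian_scale:
  "real_laplacian E p (\<lambda>z. c * u z) x = c * real_laplacian E p u x"
  by (simp add: real_laplacian_def sum_distrib_left right_diff_distrib mult.left_commute)

context weighted_graph
begin

lemma edge_vertices:
  assumes "{x, y} \<in> E"
  shows "x \<in> V" "y \<in> V"
  using edges[OF assms] by auto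

lemma nbrs_subset: "nbrs E x \<subseteq> V"
  using edge_vertices by (auto simp: nbrs_def)

lemma nbrs_sym: "y \<in> nbrs E x \<longleftrightarrow> x \<in> nbrs E y"
  by (simp add: nbrs_def insert_commute)

lemma real_laplacian_le_0_at_max:
  assumes "x \<in> V" and "\<And>y. y \<in> V \<Longrightarrow> u y \<le> u x"
  shows "real_laplacian E p u x \<le> 0"
proof -
  have "p x y * (u y - u x) \<le> 0" if "y \<in> nbrs E x" for y
  proof (rule mult_nonneg_nonpos)
    show "0 \<le> p x y"
      using that weight_nonneg by (simp add: nbrs_def)
    show "u y - u x \<le> 0"
      using that nbrs_subset assms(2) by fastforce
  qed
  hence "(\<Sum>y\<in>nbrs E x. p x y * (u y - u x)) \<le> 0"
    by (rule sum_nonpos)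
  thus ?thesis
    using degree_pos[OF assms(1)] by (simp add: real_laplacian_def divide_nonpos_pos)
qed

text \<open>
  The degree measure is the reversible measure of the Laplacian: by the symmetry of the weights,
  the contributions \<open>p\<^sub>x\<^sub>y (u(y) - u(x))\<close> and \<open>p\<^sub>y\<^sub>x (u(x) - u(y))\<close> of an edge cancel.
\<close>

lemma sum_degree_real_laplacian: "(\<Sum>x\<in>V. degree E p x * real_laplacian E p u x) = 0"
proof -
  define S where "S = (\<Sum>x\<in>V. \<Sum>y\<in>nbrs E x. p x y * (u y - u x))"
  have "S = (\<Sum>x\<in>V. \<Sum>y\<in>{y\<in>V. y \<in> nbrs E x}. p x y * (u y - u x))"
    unfolding S_def using nbrs_subset by (intro sum.cong) auto
  also have "\<dots> = (\<Sum>y\<in>V. \<Sum>x\<in>{x\<in>V. y \<in> nbrs E x}. p x y * (u y - u x))"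
    using finite_vertices finite_vertices by (rule sum.swap_restrict)
  also have "\<dots> = (\<Sum>y\<in>V. \<Sum>x\<in>nbrs E y. p y x * (- (u x - u y)))"
    using nbrs_subset nbrs_sym
    by (intro sum.cong) (auto simp: nbrs_def weight_sym)
  also have "\<dots> = - S"
    by (simp only: S_def mult_minus_right sum_negf)
  finally have "S = 0"
    by simp
  moreover have "(\<Sum>x\<in>V. degree E p x * real_laplacian E p u x) = S"
    unfolding S_def real_laplacian_def
    by (intro sum.cong refl) (use degree_pos in force)
  ultimately show ?thesis
    by simp
qed

end

section \<open>Eigenfunctions of the magnetic Laplacian\<close>

lemma mag_laplacian_scale:
  "mag_laplacian E p \<sigma> (\<lambda>z. c * f z) x = c * mag_laplacian E p \<sigma> f x"
  by (simp add: mag_laplacian_def sum_distrib_left algebra_simps)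

lemma Gamma_scale_left:
  "Gamma E p \<sigma> (\<lambda>z. c * f z) g x = c * Gamma E p \<sigma> f g x"
  by (simp add: Gamma_def laplacian_def mag_laplacian_scale sum_distrib_left algebra_simps)

lemma real_laplacian_norm_sq_eigenfunction:
  assumes eig: "mag_laplacian E p \<sigma> f x = - of_real lam * f x"
  shows "real_laplacian E p (\<lambda>z. (cmod (f z))\<^sup>2) x
    = grad_sq E p \<sigma> f x - 2 * lam * (cmod (f x))\<^sup>2"
proof -
  have sq: "f z * cnj (f z) = of_real ((cmod (f z))\<^sup>2)" for z
    by (rule complex_norm_square[symmetric])
  have "2 * Gamma E p \<sigma> f f x
      = laplacian E p (\<lambda>z. of_real ((cmod (f z))\<^sup>2)) x + of_real (2 * lam * (cmod (f x))\<^sup>2)"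
    unfolding Gamma_def eig sq by (simp add: algebra_simps sq flip: of_real_power)
  hence "Re (2 * Gamma E p \<sigma> f f x)
      = real_laplacian E p (\<lambda>z. (cmod (f z))\<^sup>2) x + 2 * lam * (cmod (f x))\<^sup>2"
    by (simp only: plus_complex.simps Re_laplacian Re_complex_of_real)
  thus ?thesis
    by (simp add: grad_sq_def)
qed

context weighted_graph
begin

lemma mag_laplacian_cong:
  assumes "x \<in> V" and "\<And>z. z \<in> V \<Longrightarrow> f z = f' z"
  shows "mag_laplacian E p \<sigma> f x = mag_laplacian E p \<sigma> f' x"
proof -
  have "f y = f' y" if "y \<in> nbrs E x" for y
    using that nbrs_subset assms(2) by blast
  thus ?thesis
    using assms by (simp add: mag_laplacian_def)
qed

lemma Gamma_cong_left:
  assumes "x \<in> V" and eq: "\<And>z. z \<in> V \<Longrightarrow> f z = f' z"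
  shows "Gamma E p \<sigma> f g x = Gamma E p \<sigma> f' g x"
proof -
  have "f y = f' y" if "y \<in> nbrs E x" for y
    using that nbrs_subset eq by blast
  thus ?thesis
    using assms mag_laplacian_cong[OF assms] by (simp add: Gamma_def laplacian_def)
qed

text \<open>
  Both mixed terms of \<open>Gamma2\<close> contain \<open>\<Delta>\<^sup>\<sigma> f = - \<lambda> f\<close>; as \<open>\<lambda>\<close> is real, it comes out of
  either slot unchanged, and only \<open>Gamma E p \<sigma> f f\<close> and its Laplacian remain.  The eigenvalue
  equation is needed at all vertices, since these terms at \<open>x\<close> involve the neighbours of \<open>x\<close>.
\<close>

lemma Gamma2_eigenfunction:
  assumes "x \<in> V" and eig: "\<And>z. z \<in> V \<Longrightarrow> mag_laplacian E p \<sigma> f z = - of_real lam * f z"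
  shows "Re (Gamma2 E p \<sigma> f f x)
    = real_laplacian E p (grad_sq E p \<sigma> f) x / 4 + lam * grad_sq E p \<sigma> f x / 2"
proof -
  have left: "Gamma E p \<sigma> (mag_laplacian E p \<sigma> f) f x = - of_real lam * Gamma E p \<sigma> f f x"
    using Gamma_cong_left[OF assms(1) eig] by (simp only: Gamma_scale_left)
  have "Gamma E p \<sigma> f (mag_laplacian E p \<sigma> f) x
      = cnj (Gamma E p \<sigma> (mag_laplacian E p \<sigma> f) f x)"
    by (rule cnj_Gamma[symmetric])
  also have "\<dots> = - of_real lam * Gamma E p \<sigma> f f x"
    unfolding left by (simp add: cnj_Gamma)
  finally have right: "Gamma E p \<sigma> f (mag_laplacian E p \<sigma> f) x
      = - of_real lam * Gamma E p \<sigma> f f x" .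
  have "real_laplacian E p (grad_sq E p \<sigma> f) x
      = 2 * real_laplacian E p (\<lambda>z. Re (Gamma E p \<sigma> f f z)) x"
    using real_laplacian_scale[of E p 2 "\<lambda>z. Re (Gamma E p \<sigma> f f z)" x]
    by (simp add: grad_sq_def[abs_def])
  thus ?thesis
    unfolding Gamma2_def left right by (simp add: Re_laplacian grad_sq_def)
qed

lemma bochner_inequality:
  assumes CD: "CD_ineq V E p \<sigma> n \<kappa>" and "x \<in> V"
    and eig: "\<And>z. z \<in> V \<Longrightarrow> mag_laplacian E p \<sigma> f z = - of_real lam * f z"
  shows "4 / n * lam\<^sup>2 * (cmod (f x))\<^sup>2 + (2 * \<kappa> - 2 * lam) * grad_sq E p \<sigma> f x
    \<le> real_laplacian E p (grad_sq E p \<sigma> f) x"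
proof -
  have "Re (Gamma2 E p \<sigma> f f x)
      \<ge> 1 / n * (cmod (mag_laplacian E p \<sigma> f x))\<^sup>2 + \<kappa> * Re (Gamma E p \<sigma> f f x)"
    using CD \<open>x \<in> V\<close> by (simp add: CD_ineq_def)
  moreover have "(cmod (mag_laplacian E p \<sigma> f x))\<^sup>2 = lam\<^sup>2 * (cmod (f x))\<^sup>2"
    by (simp add: eig[OF \<open>x \<in> V\<close>] norm_mult power_mult_distrib)
  ultimately show ?thesis
    using Gamma2_eigenfunction[OF \<open>x \<in> V\<close> eig] by (simp add: grad_sq_def algebra_simps)
qed

text \<open>
  Write \<open>\<integral>\<close> for summation over the vertices weighted by the degree.  Integrating
  \<open>\<Delta> g = G - 2 \<lambda> g\<close> gives \<open>\<integral> G = 2 \<lambda> \<integral> g\<close>, and integrating the Bochner inequality gives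
  \<open>0 \<ge> (4/n) \<lambda>\<^sup>2 \<integral> g + (2 \<kappa> - 2 \<lambda>) \<integral> G\<close>; it remains to divide by \<open>4 \<lambda> \<integral> g > 0\<close>.
\<close>

lemma lichnerowicz_bound:
  assumes CD: "CD_ineq V E p \<sigma> n \<kappa>" and "lam > 0" and nz: "\<exists>x\<in>V. f x \<noteq> 0"
    and eig: "\<And>z. z \<in> V \<Longrightarrow> mag_laplacian E p \<sigma> f z = - of_real lam * f z"
  shows "\<kappa> \<le> (1 - 1 / n) * lam"
proof -
  define A where "A = (\<Sum>x\<in>V. degree E p x * (cmod (f x))\<^sup>2)"
  define B where "B = (\<Sum>x\<in>V. degree E p x * grad_sq E p \<sigma> f x)"
  from nz obtain x where "x \<in> V" "f x \<noteq> 0"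
    by blast
  hence "A > 0"
    unfolding A_def using finite_vertices degree_pos
    by (intro sum_pos2[of _ x]) (auto simp: less_imp_le)
  have "0 = (\<Sum>x\<in>V. degree E p x * real_laplacian E p (\<lambda>z. (cmod (f z))\<^sup>2) x)"
    by (rule sum_degree_real_laplacian[symmetric])
  also have "\<dots> = (\<Sum>x\<in>V. degree E p x * grad_sq E p \<sigma> f x
      - 2 * lam * (degree E p x * (cmod (f x))\<^sup>2))"
    by (intro sum.cong refl)
      (simp add: real_laplacian_norm_sq_eigenfunction[where lam = lam, OF eig] algebra_simps)
  also have "\<dots> = B - 2 * lam * A"
    by (simp only: A_def B_def sum_subtractf sum_distrib_left)
  finally have B: "B = 2 * lam * A"
    by simp
  have "4 / n * lam\<^sup>2 * A + (2 * \<kappa> - 2 * lam) * B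
      = (\<Sum>x\<in>V. degree E p x
        * (4 / n * lam\<^sup>2 * (cmod (f x))\<^sup>2 + (2 * \<kappa> - 2 * lam) * grad_sq E p \<sigma> f x))"
    unfolding A_def B_def sum_distrib_left sum.distrib[symmetric]
    by (intro sum.cong refl) (simp only: distrib_left mult.left_commute)
  also have "\<dots> \<le> (\<Sum>x\<in>V. degree E p x * real_laplacian E p (grad_sq E p \<sigma> f) x)"
    using CD eig degree_pos
    by (intro sum_mono mult_left_mono bochner_inequality) (auto simp: less_imp_le)
  also have "\<dots> = 0"
    by (rule sum_degree_real_laplacian)
  finally have "(4 * lam * A) * (lam / n + \<kappa> - lam) \<le> 0"
    unfolding B by (simp add: algebra_simps power2_eq_square)
  moreover have "0 < 4 * lam * A"
    using \<open>lam > 0\<close> \<open>A > 0\<close> by simp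
  ultimately have "lam / n + \<kappa> - lam \<le> 0"
    by (metis mult_le_cancel_left_pos mult_zero_right)
  thus ?thesis
    by (simp add: algebra_simps)
qed

end

section \<open>The gradient estimate\<close>

theorem theorem2p5:
  fixes V :: "'a set" and E :: "'a set set" and p :: "'a \<Rightarrow> 'a \<Rightarrow> real"
    and l :: nat and \<sigma> :: "'a \<Rightarrow> 'a \<Rightarrow> complex"
    and n \<kappa> lam :: real and f :: "'a \<Rightarrow> complex"
  assumes "magnetic_graph V E p l \<sigma>"
    and "l \<ge> 1"
    and "graph_connected V E"
    and "entire_signature E l \<sigma>"
    and "\<not> balanced E \<sigma>"
    and "n > 1"
    and "\<kappa> \<noteq> 0"
    and "CD_ineq V E p \<sigma> n \<kappa>"
    and "\<exists>x\<in>V. f x \<noteq> 0"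
    and "lam > 0"
    and "\<forall>x\<in>V. - mag_laplacian E p \<sigma> f x = of_real lam * f x"
  shows "\<forall>x\<in>V. grad_sq E p \<sigma> f x
    \<le> ((8 - 2 / n) * lam - 4 * \<kappa>) * Max ((\<lambda>z. (cmod (f z))\<^sup>2) ` V)"
proof
  fix x
  assume "x \<in> V"
  interpret magnetic_graph V E p l \<sigma>
    by fact
  have eig: "mag_laplacian E p \<sigma> f z = - of_real lam * f z" if "z \<in> V" for z
    using assms(11) that by (metis minus_minus mult_minus_left)
  define G where "G = grad_sq E p \<sigma> f"
  define g where "g z = (cmod (f z))\<^sup>2" for z
  \<comment> \<open>With this \<open>c\<close> the lower bound for \<open>\<Delta> (G + c g)\<close> has the coefficient \<open>2 \<lambda> > 0\<close> at \<open>G\<close>.\<close>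
  define c where "c = 4 * lam - 2 * \<kappa>"
  define h where "h z = G z + c * g z" for z

  have "\<kappa> \<le> (1 - 1 / n) * lam"
    using assms(8,10,9) eig by (rule lichnerowicz_bound)
  moreover have "0 < lam / n" "lam / n < lam"
    using assms(6,10) by (simp_all add: field_simps)
  ultimately have c_pos: "0 \<le> c" and coeff_pos: "0 \<le> 2 * c - 2 / n * lam"
    by (simp_all add: c_def algebra_simps)

  have "finite (h ` V)" "h ` V \<noteq> {}"
    using finite_vertices \<open>x \<in> V\<close> by auto
  hence "Max (h ` V) \<in> h ` V"
    by (rule Max_in)
  then obtain z where z: "z \<in> V" and "Max (h ` V) = h z"
    by blast
  hence max: "h y \<le> h z" if "y \<in> V" for y
    using Max_ge[OF \<open>finite (h ` V)\<close>, of "h y"] that by simp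
  have "real_laplacian E p G z + c * real_laplacian E p g z = real_laplacian E p h z"
    by (simp add: h_def[abs_def] real_laplacian_add real_laplacian_scale)
  also have "\<dots> \<le> 0"
    using z max by (rule real_laplacian_le_0_at_max)
  finally have "real_laplacian E p G z + c * real_laplacian E p g z \<le> 0" .
  moreover have "real_laplacian E p g z = G z - 2 * lam * g z"
    unfolding g_def[abs_def] G_def
    using eig[OF z] by (rule real_laplacian_norm_sq_eigenfunction)
  moreover have "4 / n * lam\<^sup>2 * g z + (2 * \<kappa> - 2 * lam) * G z \<le> real_laplacian E p G z"
    unfolding g_def G_def using assms(8) z eig by (rule bochner_inequality)
  ultimately have "4 / n * lam\<^sup>2 * g z + (2 * \<kappa> - 2 * lam) * G z
      + c * (G z - 2 * lam * g z) \<le> 0"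
    by simp
  hence "(2 * lam) * (G z - (c - 2 / n * lam) * g z) \<le> 0"
    by (simp add: c_def algebra_simps power2_eq_square)
  hence G_le: "G z \<le> (c - 2 / n * lam) * g z"
    using assms(10) by (simp add: mult_le_0_iff)

  have "G x \<le> h x"
    using c_pos by (simp add: h_def g_def)
  also have "\<dots> \<le> h z"
    using \<open>x \<in> V\<close> by (rule max)
  also have "\<dots> \<le> (2 * c - 2 / n * lam) * g z"
    using G_le by (simp add: h_def algebra_simps)
  also have "\<dots> \<le> (2 * c - 2 / n * lam) * Max (g ` V)"
    using coeff_pos finite_vertices z by (intro mult_left_mono) simp_all
  also have "2 * c - 2 / n * lam = (8 - 2 / n) * lam - 4 * \<kappa>"
    by (simp add: c_def algebra_simps)
  finally show "grad_sq E p \<sigma> f x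
      \<le> ((8 - 2 / n) * lam - 4 * \<kappa>) * Max ((\<lambda>z. (cmod (f z))\<^sup>2) ` V)"
    by (simp add: G_def g_def[abs_def])
qed

end
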